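(* Let $(H,X)$ be a finite transitive permutation group and, for $n\ge 1$, put $d_n^{wr}(H)=d(H\wr\ldots\wr H\wr H)$ ($n$ factors). If $H$ is perfect, then the sequence $(d_n^{wr}(H))_{n\ge1}$ is bounded. If $H$ is not perfect, then the sequence grows linearly, i.e. there are constants $c,C>0$ such that $cn\le d_n^{wr}(H)\le Cn$ for all $n\ge 1$.
   Context: For a finite group $G$, $d(G)$ denotes the minimal number of generators of $G$. All actions are faithful: a permutation group $(G,X)$ is a group $G$ acting faithfully on a set $X$; it is a finite transitive permutation group if $X$ is finite and nonempty and $G$ acts transitively on $X$. A group $H$ is perfect if it equals its commutator subgroup $H'$. For permutation groups $(G,X)$ and $(H,Y)$, the permutational wreath product $H\wr G$ is the semidirect product $H^{|X|}\rtimes G$ (one copy of $H$ for each element of $X$, with $G$ permuting the copies via its action on $X$), with its natural faithful action on $X\times Y$; equivalently, it is the group of all permutations of $X\times Y$ of the form $(x,y)\mapsto (g(x),h_x(y))$ with $g\in G$ and $h_x\in H$ for $x\in X$. This operation is associative, so the wreath power $H\wr\ldots\wr H\wr H$ ($n$ factors) is a permutation group on $X^n$. *)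

theory Defs
  imports Complex_Main "HOL-Algebra.Group_Action" "HOL-Algebra.Generated_Groups"
begin

text \<open>Meaningful for finitely generated groups only: for other groups the value is that of
  \<open>LEAST\<close> on an empty predicate.\<close>

definition min_generators :: "('g, 'm) monoid_scheme \<Rightarrow> nat" where
  "min_generators G =
     (LEAST k. \<exists>S \<subseteq> carrier G. finite S \<and> card S = k \<and> generate G S = carrier G)"

definition perfect_group :: "('g, 'm) monoid_scheme \<Rightarrow> bool" where
  "perfect_group G \<longleftrightarrow> group G \<and> derived G (carrier G) = carrier G"

locale finite_transitive_permutation_group =
  faithful_action H X \<phi> + transitive_action H X \<phi>
  for H (structure) and X and \<phi> +
  assumes finite_points: "finite X" and nonempty_points: "X \<noteq> {}"

text \<open>In the following definitions a permutation group on \<open>X\<close> is represented by its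
  underlying set of permutations, a subset of \<^term>\<open>Bij X\<close>.
  \<open>perm_wreath K Y G X\<close> is \<open>K \<wr> G\<close>: the factor \<open>G\<close>, which moves the first
  coordinate, is the one on the right of the wreath product symbol.\<close>

definition perm_wreath ::
  "('b \<Rightarrow> 'b) set \<Rightarrow> 'b set \<Rightarrow> ('a \<Rightarrow> 'a) set \<Rightarrow> 'a set \<Rightarrow> ('a \<times> 'b \<Rightarrow> 'a \<times> 'b) set" where
  "perm_wreath K Y G X =
     {f \<in> Bij (X \<times> Y). \<exists>g\<in>G. \<exists>h \<in> X \<rightarrow> K. \<forall>x\<in>X. \<forall>y\<in>Y. f (x, y) = (g x, h x y)}"

definition words :: "'a set \<Rightarrow> nat \<Rightarrow> 'a list set" where
  "words X n = {w. set w \<subseteq> X \<and> length w = n}"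

text \<open>The \<open>n\<close>-th power is realised on words of length \<open>n\<close>: the product
  \<open>X \<times> X\<^sup>n\<close> on which \<open>(G \<wr> \<dots> \<wr> G) \<wr> G\<close> acts is identified
  with words of length \<open>n + 1\<close> through \<^const>\<open>Cons\<close>. By associativity the bracketing does
  not matter. The power for \<open>n = 0\<close> is the trivial group on the empty word; its
  wreath product with \<open>G\<close> is \<open>G\<close> acting on words of length one.\<close>

primrec wreath_power :: "('a \<Rightarrow> 'a) set \<Rightarrow> 'a set \<Rightarrow> nat \<Rightarrow> ('a list \<Rightarrow> 'a list) set" where
  "wreath_power G X 0 = {\<lambda>w\<in>words X 0. w}"
| "wreath_power G X (Suc n) =
     (\<lambda>f. \<lambda>w\<in>words X (Suc n). case f (hd w, tl w) of (x, v) \<Rightarrow> x # v) `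
       perm_wreath (wreath_power G X n) (words X n) G X"

definition wreath_power_group ::
  "('g, 'm) monoid_scheme \<Rightarrow> 'a set \<Rightarrow> ('g \<Rightarrow> 'a \<Rightarrow> 'a) \<Rightarrow> nat \<Rightarrow> ('a list \<Rightarrow> 'a list) monoid" where
  "wreath_power_group H X \<phi> n =
     BijGroup (words X n) \<lparr>carrier := wreath_power (\<phi> ` carrier H) X n\<rparr>"

definition d_wr :: "('g, 'm) monoid_scheme \<Rightarrow> 'a set \<Rightarrow> ('g \<Rightarrow> 'a \<Rightarrow> 'a) \<Rightarrow> nat \<Rightarrow> nat" where
  "d_wr H X \<phi> n = min_generators (wreath_power_group H X \<phi> n)"

lemma words_0: "words X 0 = {[]}"
  by (auto simp: words_def)

lemma words_Suc_iff: "w \<in> words X (Suc n) \<longleftrightarrow> (\<exists>x v. w = x # v \<and> x \<in> X \<and> v \<in> words X n)"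
  by (cases w) (auto simp: words_def)

lemma Cons_in_words: "x # v \<in> words X (Suc n) \<longleftrightarrow> x \<in> X \<and> v \<in> words X n"
  by (auto simp: words_def)

lemma bij_betw_wreath_form:
  assumes "bij_betw g X X" and "\<And>x. x \<in> X \<Longrightarrow> bij_betw (h x) Y Y"
  shows "bij_betw (\<lambda>(x, y). (g x, h x y)) (X \<times> Y) (X \<times> Y)"
proof -
  have "inj_on (\<lambda>(x, y). (g x, h x y)) (X \<times> Y)"
    using assms unfolding bij_betw_def inj_on_def by auto
  moreover have "(\<lambda>(x, y). (g x, h x y)) ` (X \<times> Y) = X \<times> Y"
  proof (intro equalityI subsetI)
    fix p assume "p \<in> X \<times> Y"
    then obtain x y where p: "p = (x, y)" "x \<in> X" "y \<in> Y" by auto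
    then obtain x' where x': "x' \<in> X" "g x' = x"
      using assms(1) by (metis bij_betw_imp_surj_on imageE)
    then obtain y' where "y' \<in> Y" "h x' y' = y"
      using assms(2) p by (metis bij_betw_imp_surj_on imageE)
    with x' p show "p \<in> (\<lambda>(x, y). (g x, h x y)) ` (X \<times> Y)" by force
  next
    fix p assume "p \<in> (\<lambda>(x, y). (g x, h x y)) ` (X \<times> Y)"
    with assms show "p \<in> X \<times> Y" by (auto dest: bij_betwE)
  qed
  ultimately show ?thesis by (simp add: bij_betw_def)
qed

text \<open>The membership condition \<open>f \<in> Bij (X \<times> Y)\<close> in the definition of the wreath
  product excludes no choice of \<open>g\<close> and \<open>h\<close>.\<close>

lemma perm_wreath_eq:
  assumes "G \<subseteq> Bij X" and "K \<subseteq> Bij Y"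
  shows "perm_wreath K Y G X =
    {\<lambda>(x, y)\<in>X \<times> Y. (g x, h x y) | g h. g \<in> G \<and> h \<in> X \<rightarrow> K}"
proof (intro equalityI subsetI)
  fix f assume "f \<in> perm_wreath K Y G X"
  then obtain g h where f: "f \<in> Bij (X \<times> Y)" "g \<in> G" "h \<in> X \<rightarrow> K"
      "\<forall>x\<in>X. \<forall>y\<in>Y. f (x, y) = (g x, h x y)"
    by (auto simp: perm_wreath_def)
  have "f = (\<lambda>(x, y)\<in>X \<times> Y. (g x, h x y))"
    by (rule extensionalityI[of _ "X \<times> Y"]) (use f in \<open>auto simp: Bij_def\<close>)
  with f show "f \<in> {\<lambda>(x, y)\<in>X \<times> Y. (g x, h x y) | g h. g \<in> G \<and> h \<in> X \<rightarrow> K}" by blast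
next
  fix f assume "f \<in> {\<lambda>(x, y)\<in>X \<times> Y. (g x, h x y) | g h. g \<in> G \<and> h \<in> X \<rightarrow> K}"
  then obtain g h where f: "f = (\<lambda>(x, y)\<in>X \<times> Y. (g x, h x y))" and gh: "g \<in> G" "h \<in> X \<rightarrow> K"
    by blast
  have "bij_betw (\<lambda>(x, y). (g x, h x y)) (X \<times> Y) (X \<times> Y)"
    by (rule bij_betw_wreath_form) (use assms gh in \<open>auto simp: Bij_def Pi_def\<close>)
  then have "f \<in> Bij (X \<times> Y)"
    by (simp add: f Bij_def)
  with gh show "f \<in> perm_wreath K Y G X"
    unfolding perm_wreath_def f by auto
qed

lemma wreath_power_1:
  assumes "G \<subseteq> Bij X"
  shows "wreath_power G X 1 = (\<lambda>g. \<lambda>w\<in>words X 1. [g (hd w)]) ` G"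
proof -
  let ?i = "\<lambda>w\<in>words X 0. w"
  have "{?i} \<subseteq> Bij (words X 0)" by (simp add: id_Bij)
  from perm_wreath_eq[OF assms this]
  have *: "perm_wreath {?i} (words X 0) G X =
      (\<lambda>g. \<lambda>(x, y)\<in>X \<times> words X 0. (g x, y)) ` G" (is "_ = ?R")
  proof -
    have "(\<lambda>(x, y)\<in>X \<times> words X 0. (g x, h x y)) = (\<lambda>(x, y)\<in>X \<times> words X 0. (g x, y))"
      if "h \<in> X \<rightarrow> {?i}" for g :: "'a \<Rightarrow> 'a" and h
      using that by (intro restrict_ext) (auto simp: Pi_def)
    note eq = this
    have "{\<lambda>(x, y)\<in>X \<times> words X 0. (g x, h x y) | g h. g \<in> G \<and> h \<in> X \<rightarrow> {?i}} = ?R"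
    proof (intro equalityI subsetI)
      fix f assume "f \<in> ?R"
      then obtain g where g: "g \<in> G" "f = (\<lambda>(x, y)\<in>X \<times> words X 0. (g x, y))" by blast
      have i: "(\<lambda>_. ?i) \<in> X \<rightarrow> {?i}" by simp
      show "f \<in> {\<lambda>(x, y)\<in>X \<times> words X 0. (g x, h x y) | g h. g \<in> G \<and> h \<in> X \<rightarrow> {?i}}"
        unfolding g(2) eq[OF i, symmetric]
          by (intro CollectI exI[of _ g] exI[of _ "\<lambda>_. ?i"] conjI refl g(1) i)
    qed (use eq in blast)
    with perm_wreath_eq[OF assms \<open>{?i} \<subseteq> Bij (words X 0)\<close>] show ?thesis by simp
  qed
  show ?thesis
    unfolding One_nat_def wreath_power.simps * image_image
    by (intro image_cong refl restrict_ext)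
       (auto simp: words_Suc_iff words_0)
qed

lemma subgroup_perm_wreath:
  assumes G: "subgroup G (BijGroup X)" and K: "subgroup K (BijGroup Y)"
  shows "subgroup (perm_wreath K Y G X) (BijGroup (X \<times> Y))"
proof -
  interpret BX: group "BijGroup X" by (rule group_BijGroup)
  interpret BY: group "BijGroup Y" by (rule group_BijGroup)
  interpret BXY: group "BijGroup (X \<times> Y)" by (rule group_BijGroup)
  have GB: "G \<subseteq> Bij X" and KB: "K \<subseteq> Bij Y"
    using subgroup.subset[OF G] subgroup.subset[OF K] by (auto simp: BijGroup_def)
  have comp_G: "compose X a b \<in> G" if "a \<in> G" "b \<in> G" for a b
    using subgroup.m_closed[OF G that] that GB by (simp add: BijGroup_def subset_iff)
  have comp_K: "compose Y a b \<in> K" if "a \<in> K" "b \<in> K" for a b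
    using subgroup.m_closed[OF K that] that KB by (simp add: BijGroup_def subset_iff)
  have inv_G: "(\<lambda>x\<in>X. inv_into X a x) \<in> G" if "a \<in> G" for a
    using subgroup.m_inv_closed[OF G that] that GB by (simp add: inv_BijGroup subset_iff)
  have inv_K: "(\<lambda>x\<in>Y. inv_into Y a x) \<in> K" if "a \<in> K" for a
    using subgroup.m_inv_closed[OF K that] that KB by (simp add: inv_BijGroup subset_iff)
  have one_G: "(\<lambda>x\<in>X. x) \<in> G" and one_K: "(\<lambda>x\<in>Y. x) \<in> K"
    using subgroup.one_closed[OF G] subgroup.one_closed[OF K] by (simp_all add: BijGroup_def)
  show ?thesis
  proof (rule BXY.subgroupI)
    show "perm_wreath K Y G X \<subseteq> carrier (BijGroup (X \<times> Y))"
      by (auto simp: perm_wreath_def BijGroup_def)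
    have "(\<lambda>p\<in>X \<times> Y. p) \<in> perm_wreath K Y G X"
      using one_G one_K unfolding perm_wreath_def
      by (auto simp: id_Bij intro!: bexI[of _ "\<lambda>x\<in>X. x"] bexI[of _ "\<lambda>x. \<lambda>y\<in>Y. y"])
    then show "perm_wreath K Y G X \<noteq> {}" by blast
  next
    fix f assume "f \<in> perm_wreath K Y G X"
    then obtain g h where f: "f \<in> Bij (X \<times> Y)" "g \<in> G" "h \<in> X \<rightarrow> K"
        "\<And>x y. x \<in> X \<Longrightarrow> y \<in> Y \<Longrightarrow> f (x, y) = (g x, h x y)"
      by (auto simp: perm_wreath_def)
    let ?g = "\<lambda>x\<in>X. inv_into X g x"
    let ?h = "\<lambda>x. \<lambda>y\<in>Y. inv_into Y (h (?g x)) y"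
    have gX: "bij_betw g X X" using f GB by (auto simp: Bij_def)
    have hY: "bij_betw (h x) Y Y" if "x \<in> X" for x
      using f KB that by (auto simp: Bij_def Pi_def)
    have g_in: "inv_into X g x \<in> X" "g (inv_into X g x) = x" if "x \<in> X" for x
      using gX that by (auto simp: bij_betw_def f_inv_into_f inv_into_into)
    have h_in: "inv_into Y (h x) y \<in> Y" "h x (inv_into Y (h x) y) = y" if "x \<in> X" "y \<in> Y" for x y
      using hY[OF that(1)] that by (auto simp: bij_betw_def f_inv_into_f inv_into_into)
    have "inv_into (X \<times> Y) f (x, y) = (?g x, ?h x y)" if "x \<in> X" "y \<in> Y" for x y
    proof (rule inv_into_f_eq)
      show "inj_on f (X \<times> Y)" using f by (auto simp: Bij_def bij_betw_def)
      show "(?g x, ?h x y) \<in> X \<times> Y" using that g_in h_in by auto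
      show "f (?g x, ?h x y) = (x, y)" using that g_in h_in f(4) by simp
    qed
    moreover have "?h \<in> X \<rightarrow> K"
    proof (rule Pi_I)
      fix x assume "x \<in> X"
      then have "h (?g x) \<in> K" using g_in f by auto
      then show "?h x \<in> K" by (rule inv_K)
    qed
    moreover have "?g \<in> G" using inv_G f by blast
    ultimately have "(\<lambda>p\<in>X \<times> Y. inv_into (X \<times> Y) f p) \<in> perm_wreath K Y G X"
      unfolding perm_wreath_def using restrict_inv_into_Bij[OF f(1)]
      by (intro CollectI conjI bexI[of _ ?g] bexI[of _ ?h]) simp_all
    then show "inv\<^bsub>BijGroup (X \<times> Y)\<^esub> f \<in> perm_wreath K Y G X"
      using f by (simp add: inv_BijGroup)
  next
    fix f f' assume ff': "f \<in> perm_wreath K Y G X" "f' \<in> perm_wreath K Y G X"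
    then obtain g h where f: "f \<in> Bij (X \<times> Y)" "g \<in> G" "h \<in> X \<rightarrow> K"
        "\<And>x y. x \<in> X \<Longrightarrow> y \<in> Y \<Longrightarrow> f (x, y) = (g x, h x y)"
      by (auto simp: perm_wreath_def)
    from ff' obtain g' h' where f': "f' \<in> Bij (X \<times> Y)" "g' \<in> G" "h' \<in> X \<rightarrow> K"
        "\<And>x y. x \<in> X \<Longrightarrow> y \<in> Y \<Longrightarrow> f' (x, y) = (g' x, h' x y)"
      by (auto simp: perm_wreath_def)
    let ?h = "\<lambda>x. compose Y (h (g' x)) (h' x)"
    have g': "g' x \<in> X" if "x \<in> X" for x
      using f'(2) GB that by (auto simp: Bij_def dest: bij_betwE)
    have h': "h' x y \<in> Y" if "x \<in> X" "y \<in> Y" for x y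
    proof -
      have "h' x \<in> Bij Y" using f'(3) KB that by auto
      then show ?thesis using that by (auto simp: Bij_def dest: bij_betwE)
    qed
    have "compose (X \<times> Y) f f' (x, y) = (compose X g g' x, ?h x y)" if "x \<in> X" "y \<in> Y" for x y
      using that f f' g' h' by (simp add: compose_eq)
    moreover have "?h \<in> X \<rightarrow> K"
    proof (rule Pi_I)
      fix x assume "x \<in> X"
      then have "h (g' x) \<in> K" "h' x \<in> K" using g' f f' by auto
      then show "?h x \<in> K" by (rule comp_K)
    qed
    ultimately have "compose (X \<times> Y) f f' \<in> perm_wreath K Y G X"
      unfolding perm_wreath_def using compose_Bij[OF f(1) f'(1)] comp_G[OF f(2) f'(2)] by auto
    then show "f \<otimes>\<^bsub>BijGroup (X \<times> Y)\<^esub> f' \<in> perm_wreath K Y G X"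
      using f f' by (simp add: BijGroup_def)
  qed
qed

lemma hom_transport_words:
  "(\<lambda>f. \<lambda>w\<in>words X (Suc n). case f (hd w, tl w) of (x, v) \<Rightarrow> x # v)
     \<in> hom (BijGroup (X \<times> words X n)) (BijGroup (words X (Suc n)))" (is "?T \<in> _")
proof -
  let ?A = "X \<times> words X n" and ?B = "words X (Suc n)"
  have e: "bij_betw (\<lambda>w. (hd w, tl w)) ?B ?A"
    by (rule bij_betw_byWitness[where f' = "\<lambda>(x, v). x # v"]) (auto simp: words_Suc_iff)
  have e': "bij_betw (\<lambda>(x, v). x # v) ?A ?B"
    by (rule bij_betw_byWitness[where f' = "\<lambda>w. (hd w, tl w)"]) (auto simp: words_Suc_iff)
  have T: "?T f \<in> Bij ?B" if "f \<in> Bij ?A" for f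
  proof -
    have "bij_betw f ?A ?A" using that by (simp add: Bij_def)
    from bij_betw_trans[OF bij_betw_trans[OF e this] e']
    have "bij_betw (\<lambda>w. case f (hd w, tl w) of (x, v) \<Rightarrow> x # v) ?B ?B" by (simp add: comp_def)
    then show ?thesis by (simp add: Bij_def)
  qed
  have "?T (compose ?A f f') = compose ?B (?T f) (?T f')"
    if "f \<in> Bij ?A" "f' \<in> Bij ?A" for f f'
  proof (rule extensionalityI[of _ ?B])
    fix w assume w: "w \<in> ?B"
    then have p: "(hd w, tl w) \<in> ?A" by (auto simp: words_Suc_iff)
    then have "f' (hd w, tl w) \<in> ?A"
      using that(2) by (blast dest: Bij_imp_funcset funcset_mem)
    then obtain x v where xv: "f' (hd w, tl w) = (x, v)" "x \<in> X" "v \<in> words X n" by auto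
    show "?T (compose ?A f f') w = compose ?B (?T f) (?T f') w"
      using w p xv by (simp add: compose_eq Cons_in_words)
  qed auto
  with T show ?thesis
    by (auto simp: hom_def BijGroup_def compose_Bij)
qed

lemma subgroup_wreath_power:
  assumes "subgroup G (BijGroup X)"
  shows "subgroup (wreath_power G X n) (BijGroup (words X n))"
proof (induction n)
  case 0
  have "wreath_power G X 0 = {\<one>\<^bsub>BijGroup (words X 0)\<^esub>}"
    by (simp add: BijGroup_def)
  then show ?case
    using group.triv_subgroup[OF group_BijGroup] by metis
next
  case (Suc n)
  interpret group_hom "BijGroup (X \<times> words X n)" "BijGroup (words X (Suc n))"
    "\<lambda>f. \<lambda>w\<in>words X (Suc n). case f (hd w, tl w) of (x, v) \<Rightarrow> x # v"
    by (intro group_hom.intro group_BijGroup group_hom_axioms.intro hom_transport_words)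
  show ?case
    using subgroup_img_is_subgroup[OF subgroup_perm_wreath[OF assms Suc.IH]] by simp
qed

lemma (in group_action) group_wreath_power_group:
  "group (wreath_power_group G E \<phi> n)"
proof -
  interpret h: group_hom G "BijGroup E" \<phi> by (rule group_hom)
  have "subgroup (\<phi> ` carrier G) (BijGroup E)"
    by (rule h.img_is_subgroup)
  then have "subgroup (wreath_power (\<phi> ` carrier G) E n) (BijGroup (words E n))"
    by (rule subgroup_wreath_power)
  then show ?thesis
    unfolding wreath_power_group_def by (rule subgroup.subgroup_is_group) (rule group_BijGroup)
qed

end

theory Submission
  imports Defs "HOL-Algebra.FiniteProduct"
begin

text \<open>Let \<open>W\<^sub>n\<close> be the \<open>n\<close>-th wreath power. The rooted copy of \<open>H\<close>, acting on the first letter,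
  together with generators of \<open>W\<^sub>n\<close> placed below a single letter generates \<open>W\<^sub>n\<^sub>+\<^sub>1\<close>, because \<open>H\<close>
  is transitive; this gives the linear upper bound.

  For every level \<open>i < n\<close>, multiplying the labels of the vertices of level \<open>i\<close> in the abelianization
  \<open>A = H/H'\<close> is a homomorphism, and jointly these map \<open>W\<^sub>n\<close> onto \<open>A\<^sup>n\<close>. The image of a group with
  \<open>k\<close> generators in \<open>A\<^sup>n\<close> has at most \<open>|A|\<^sup>k\<close> elements, since \<open>A\<close> has exponent dividing \<open>|A|\<close>;
  so \<open>k \<ge> n\<close> if \<open>A\<close> is nontrivial.

  If \<open>H\<close> is perfect and nontrivial, then \<open>X\<close> has three distinct points \<open>x, y, z\<close>. Take the rooted
  permutations \<open>a\<^sub>h\<close> and the recursively defined elements \<open>b\<^sub>h\<close>, acting as \<open>b\<^sub>h\<close> below \<open>x\<close> and as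
  \<open>a\<^sub>h\<close> below \<open>y\<close>, and \<open>c\<^sub>h\<close>, acting as \<open>c\<^sub>h\<close> below \<open>z\<close> and as \<open>a\<^sub>h\<close> below \<open>y\<close>. The commutator of
  \<open>b\<^sub>g\<close> and \<open>c\<^sub>h\<close> acts as the rooted permutation of the commutator of \<open>g\<close> and \<open>h\<close> below \<open>y\<close> and
  trivially elsewhere. Perfectness thus isolates all \<open>a\<^sub>h\<close> below \<open>y\<close>, hence also \<open>b\<^sub>h\<close> below \<open>x\<close> and
  \<open>c\<^sub>h\<close> below \<open>z\<close>, and induction on \<open>n\<close> shows that these \<open>3|H|\<close> elements generate \<open>W\<^sub>n\<close>.\<close>

section \<open>Generators and homomorphisms to a finite abelian group\<close>

lemma min_generators_le:
  assumes "S \<subseteq> carrier G" "finite S" "generate G S = carrier G"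
  shows "min_generators G \<le> card S"
  unfolding min_generators_def using assms by (intro Least_le) blast

lemma min_generators_attained:
  assumes "S \<subseteq> carrier G" "finite S" "generate G S = carrier G"
  obtains T where "T \<subseteq> carrier G" "finite T" "card T = min_generators G"
    "generate G T = carrier G"
proof -
  have "\<exists>k. \<exists>S \<subseteq> carrier G. finite S \<and> card S = k \<and> generate G S = carrier G"
    using assms by blast
  from LeastI_ex[OF this] show ?thesis
    unfolding min_generators_def[symmetric] using that by blast
qed

text \<open>The exponents only record how \<open>w\<close> is spelled in \<open>S\<close>, so the
  same \<open>e\<close> serves every \<open>i\<close>; commutativity of the target lets equal
  letters be collected.\<close>

lemma (in comm_group) hom_eq_finprod_generators:
  fixes G' :: "('c, 'd) monoid_scheme"
  assumes "group G'" and fin: "finite (carrier G)"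
    and S: "S \<subseteq> carrier G'" "finite S" and w: "w \<in> generate G' S"
    and hom: "\<And>i. i \<in> I \<Longrightarrow> \<theta> i \<in> hom G' G"
  shows "\<exists>e :: 'c \<Rightarrow> nat. \<forall>i\<in>I. \<theta> i w = (\<Otimes>s\<in>S. \<theta> i s [^] e s)"
  using w
proof (induction rule: generate.induct)
  case one
  have "\<forall>i\<in>I. \<theta> i \<one>\<^bsub>G'\<^esub> = (\<Otimes>s\<in>S. \<theta> i s [^] (0::nat))"
    using hom hom_one[OF _ assms(1) is_group] by simp
  then show ?case by (intro exI[of _ "\<lambda>_. 0"])
next
  case (incl s)
  have "\<theta> i s = (\<Otimes>t\<in>S. \<theta> i t [^] (if t = s then 1 else 0 :: nat))" if "i \<in> I" for i
  proof -
    have c: "\<theta> i t \<in> carrier G" if "t \<in> S" for t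
      using hom[OF \<open>i \<in> I\<close>] S that by (auto simp: hom_def)
    have "(\<Otimes>t\<in>S. \<theta> i t [^] (if t = s then 1 else 0 :: nat)) = (\<Otimes>t\<in>S. if t = s then \<theta> i t else \<one>)"
      using c by (intro finprod_cong) (auto simp: simp_implies_def)
    then show ?thesis
      using finprod_singleton_swap[of s S "\<theta> i"] incl S c by auto
  qed
  then show ?case by (intro exI[of _ "\<lambda>t. if t = s then 1 else 0"]) blast
next
  case (inv s)
  \<comment> \<open>The inverse in a finite group of order m is the power with exponent m - 1, so
    exponents can stay natural numbers.\<close>
  let ?m = "card (carrier G) - 1"
  have "\<theta> i (inv\<^bsub>G'\<^esub> s) = (\<Otimes>t\<in>S. \<theta> i t [^] (if t = s then ?m else 0))" if "i \<in> I" for i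
  proof -
    interpret h: group_hom G' G "\<theta> i"
      using assms(1) hom[OF that] by (intro group_hom.intro is_group group_hom_axioms.intro)
    have c: "\<theta> i t \<in> carrier G" if "t \<in> S" for t
      using S that by auto
    have "Suc ?m = card (carrier G)"
      using fin card_gt_0_iff[of "carrier G"] by auto
    then have "\<theta> i s [^] ?m \<otimes> \<theta> i s = \<one>"
      using power_order_eq_one[OF fin c[OF inv]] nat_pow_Suc[of "\<theta> i s" ?m] by simp
    then have "\<theta> i (inv\<^bsub>G'\<^esub> s) = \<theta> i s [^] ?m"
      using inv S c by (simp add: inv_equality subset_iff)
    moreover have "(\<Otimes>t\<in>S. \<theta> i t [^] (if t = s then ?m else 0)) =
        (\<Otimes>t\<in>S. if t = s then \<theta> i t [^] ?m else \<one>)"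
      using c by (intro finprod_cong) (auto simp: simp_implies_def)
    ultimately show ?thesis
      using finprod_singleton_swap[of s S "\<lambda>t. \<theta> i t [^] ?m"] inv S c by auto
  qed
  then show ?case by (intro exI[of _ "\<lambda>t. if t = s then ?m else 0"]) blast
next
  case (eng w w')
  then obtain e e' :: "'c \<Rightarrow> nat" where e: "\<forall>i\<in>I. \<theta> i w = (\<Otimes>s\<in>S. \<theta> i s [^] e s)"
    "\<forall>i\<in>I. \<theta> i w' = (\<Otimes>s\<in>S. \<theta> i s [^] e' s)" by blast
  have ww': "w \<in> carrier G'" "w' \<in> carrier G'"
    using eng group.generate_in_carrier[OF assms(1) S(1)] by auto
  have "\<theta> i (w \<otimes>\<^bsub>G'\<^esub> w') = (\<Otimes>s\<in>S. \<theta> i s [^] (e s + e' s))" if "i \<in> I" for i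
  proof -
    have c: "\<theta> i t \<in> carrier G" if "t \<in> S" for t
      using hom[OF \<open>i \<in> I\<close>] S that by (auto simp: hom_def)
    have "(\<Otimes>s\<in>S. \<theta> i s [^] (e s + e' s)) = (\<Otimes>s\<in>S. \<theta> i s [^] e s \<otimes> \<theta> i s [^] e' s)"
      using c by (intro finprod_cong) (auto simp: simp_implies_def nat_pow_mult)
    also have "\<dots> = (\<Otimes>s\<in>S. \<theta> i s [^] e s) \<otimes> (\<Otimes>s\<in>S. \<theta> i s [^] e' s)"
      using c by (intro finprod_multf) auto
    finally show ?thesis
      using e that hom_mult[OF hom[OF that] ww'] by simp
  qed
  then show ?case by (intro exI[of _ "\<lambda>s. e s + e' s"]) blast
qed

text \<open>A tuple is determined by the common exponents of its word, and these matter only modulo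
  the order of the target. Hence the bound does not depend on \<open>I\<close>.\<close>

lemma (in comm_group) card_hom_tuples_le:
  fixes G' :: "('c, 'd) monoid_scheme"
  assumes "group G'" and fin: "finite (carrier G)"
    and S: "S \<subseteq> carrier G'" "finite S" "generate G' S = carrier G'"
    and hom: "\<And>i. i \<in> I \<Longrightarrow> \<theta> i \<in> hom G' G"
  shows "card ((\<lambda>w. \<lambda>i\<in>I. \<theta> i w) ` carrier G') \<le> card (carrier G) ^ card S"
proof -
  let ?m = "card (carrier G)"
  let ?F = "\<lambda>e. \<lambda>i\<in>I. \<Otimes>s\<in>S. \<theta> i s [^] (e s :: nat)"
  have m: "?m > 0" using fin card_gt_0_iff[of "carrier G"] by auto
  have mod_eq: "a [^] (k mod ?m) = a [^] k" if "a \<in> carrier G" for a and k :: nat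
  proof -
    have "a [^] k = a [^] (?m * (k div ?m) + k mod ?m)" by simp
    also have "\<dots> = (a [^] ?m) [^] (k div ?m) \<otimes> a [^] (k mod ?m)"
      using that by (metis nat_pow_mult nat_pow_pow)
    finally show ?thesis using that fin by (simp add: power_order_eq_one)
  qed
  have "(\<lambda>w. \<lambda>i\<in>I. \<theta> i w) ` carrier G' \<subseteq> ?F ` (S \<rightarrow>\<^sub>E {..<?m})"
  proof (rule image_subsetI)
    fix w assume "w \<in> carrier G'"
    then obtain e :: "'c \<Rightarrow> nat" where e: "\<forall>i\<in>I. \<theta> i w = (\<Otimes>s\<in>S. \<theta> i s [^] e s)"
      using hom_eq_finprod_generators[OF assms(1,2) S(1,2), of w I \<theta>] S(3) hom by blast
    have "(\<Otimes>s\<in>S. \<theta> i s [^] (\<lambda>s\<in>S. e s mod ?m) s) = \<theta> i w" if "i \<in> I" for i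
    proof -
      have "\<theta> i t \<in> carrier G" if "t \<in> S" for t
        using hom[OF \<open>i \<in> I\<close>] S that by (auto simp: hom_def)
      then have "(\<Otimes>s\<in>S. \<theta> i s [^] (\<lambda>s\<in>S. e s mod ?m) s) = (\<Otimes>s\<in>S. \<theta> i s [^] e s)"
        by (intro finprod_cong) (auto simp: simp_implies_def mod_eq)
      with e that show ?thesis by simp
    qed
    then have "(\<lambda>i\<in>I. \<theta> i w) = ?F (\<lambda>s\<in>S. e s mod ?m)" by (intro restrict_ext) simp
    moreover have "(\<lambda>s\<in>S. e s mod ?m) \<in> S \<rightarrow>\<^sub>E {..<?m}" using m by auto
    ultimately show "(\<lambda>i\<in>I. \<theta> i w) \<in> ?F ` (S \<rightarrow>\<^sub>E {..<?m})" by (rule image_eqI)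
  qed
  then have "card ((\<lambda>w. \<lambda>i\<in>I. \<theta> i w) ` carrier G') \<le> card (S \<rightarrow>\<^sub>E {..<?m})"
    using S by (intro surj_card_le finite_PiE) auto
  also have "\<dots> = ?m ^ card S" using S by (simp add: card_PiE)
  finally show ?thesis .
qed

text \<open>Of the four factors only \<open>v\<close> and \<open>t\<close> may fail to commute, so
  \<open>u\<close> and \<open>s\<close> cancel from the commutator.\<close>

lemma (in group) commutator_of_commuting_products:
  assumes c: "u \<in> carrier G" "v \<in> carrier G" "s \<in> carrier G" "t \<in> carrier G"
    and comm: "u \<otimes> v = v \<otimes> u" "u \<otimes> s = s \<otimes> u" "u \<otimes> t = t \<otimes> u" "v \<otimes> s = s \<otimes> v" "s \<otimes> t = t \<otimes> s"
  shows "(u \<otimes> v) \<otimes> (s \<otimes> t) \<otimes> inv (u \<otimes> v) \<otimes> inv (s \<otimes> t) = v \<otimes> t \<otimes> inv v \<otimes> inv t"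
proof -
  have cancel: "inv x \<otimes> (x \<otimes> z) = z" if "x \<in> carrier G" "z \<in> carrier G" for x z
    using that by (simp add: m_assoc[symmetric])
  have lcomm: "x \<otimes> (y \<otimes> z) = y \<otimes> (x \<otimes> z)"
    if "x \<otimes> y = y \<otimes> x" "x \<in> carrier G" "y \<in> carrier G" "z \<in> carrier G" for x y z
    using that by (simp add: m_assoc[symmetric])
  \<comment> \<open>As rewrite rules these move \<open>s\<close> to the left and \<open>u\<close> to
    the right and never exchange \<open>v\<close> with \<open>t\<close>.\<close>
  note ac = m_assoc comm(1-4) comm(5)[symmetric] lcomm[OF comm(1)] lcomm[OF comm(2)]
    lcomm[OF comm(3)] lcomm[OF comm(4)] lcomm[OF comm(5)[symmetric]]
  have "(s \<otimes> t) \<otimes> (u \<otimes> v) = (t \<otimes> v) \<otimes> (s \<otimes> u)"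
    using c by (simp add: ac)
  then have "v \<otimes> t \<otimes> inv v \<otimes> inv t \<otimes> ((s \<otimes> t) \<otimes> (u \<otimes> v)) =
      v \<otimes> t \<otimes> (s \<otimes> u)"
    using c by (simp add: m_assoc cancel)
  also have "\<dots> = (u \<otimes> v) \<otimes> (s \<otimes> t)" using c by (simp add: ac)
  finally have "(u \<otimes> v) \<otimes> (s \<otimes> t) = v \<otimes> t \<otimes> inv v \<otimes> inv t \<otimes> ((s \<otimes> t) \<otimes> (u \<otimes> v))" ..
  then have "(u \<otimes> v) \<otimes> (s \<otimes> t) \<otimes> inv ((s \<otimes> t) \<otimes> (u \<otimes> v)) = v \<otimes> t \<otimes> inv v \<otimes> inv t"
    using c by (simp add: inv_solve_right')
  then show ?thesis
    using c by (simp only: inv_mult_group m_assoc m_closed inv_closed)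
qed


section \<open>Wreath recursion on words\<close>

definition wr :: "'a set \<Rightarrow> nat \<Rightarrow> ('a \<Rightarrow> 'a) \<Rightarrow> ('a \<Rightarrow> 'a list \<Rightarrow> 'a list) \<Rightarrow> 'a list \<Rightarrow> 'a list" where
  "wr X n g h = (\<lambda>w\<in>words X (Suc n). g (hd w) # h (hd w) (tl w))"

text \<open>The tail \<open>replicate n x\<close> is just a convenient word of length
  \<open>n\<close>; for \<open>wr\<close> elements the first letter of the image does not depend on
  it.\<close>

definition root_part :: "'a set \<Rightarrow> nat \<Rightarrow> ('a list \<Rightarrow> 'a list) \<Rightarrow> 'a \<Rightarrow> 'a" where
  "root_part X n f = (\<lambda>x\<in>X. hd (f (x # replicate n x)))"

definition word_section :: "'a set \<Rightarrow> nat \<Rightarrow> ('a list \<Rightarrow> 'a list) \<Rightarrow> 'a \<Rightarrow> 'a list \<Rightarrow> 'a list" where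
  "word_section X n f x = (\<lambda>v\<in>words X n. tl (f (x # v)))"

lemma mult_BijGroup: "f \<in> Bij S \<Longrightarrow> g \<in> Bij S \<Longrightarrow> f \<otimes>\<^bsub>BijGroup S\<^esub> g = compose S f g"
  by (simp add: BijGroup_def)

lemma carrier_BijGroup: "carrier (BijGroup S) = Bij S"
  by (simp add: BijGroup_def)

lemma one_BijGroup: "\<one>\<^bsub>BijGroup S\<^esub> = (\<lambda>x\<in>S. x)"
  by (simp add: BijGroup_def)

lemma Bij_app: "f \<in> Bij S \<Longrightarrow> x \<in> S \<Longrightarrow> f x \<in> S"
  by (auto simp: Bij_def dest: bij_betwE)

lemma finite_Bij:
  assumes "finite S"
  shows "finite (Bij S)"
proof (rule finite_subset)
  show "Bij S \<subseteq> S \<rightarrow>\<^sub>E S" by (auto simp: PiE_def Bij_app Bij_def dest: bij_betwE)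
  show "finite (S \<rightarrow>\<^sub>E S)" using assms by (simp add: finite_PiE)
qed

lemma replicate_in_words: "x \<in> X \<Longrightarrow> replicate n x \<in> words X n"
  by (auto simp: words_def)

lemma root_part_wr: "g \<in> Bij X \<Longrightarrow> root_part X n (wr X n g h) = g"
  by (rule extensionalityI[of _ X])
     (auto simp: root_part_def wr_def Cons_in_words replicate_in_words Bij_def)

lemma word_section_wr:
  "x \<in> X \<Longrightarrow> h x \<in> Bij (words X n) \<Longrightarrow> word_section X n (wr X n g h) x = h x"
  by (rule extensionalityI[of _ "words X n"])
     (auto simp: word_section_def wr_def Cons_in_words Bij_def)

lemma wr_cong: "(\<And>x. x \<in> X \<Longrightarrow> g x = g' x) \<Longrightarrow> (\<And>x. x \<in> X \<Longrightarrow> h x = h' x) \<Longrightarrow> wr X n g h = wr X n g' h'"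
  unfolding wr_def by (intro restrict_ext) (auto simp: words_Suc_iff)

lemma wr_in_Bij:
  assumes "g \<in> Bij X" "h \<in> X \<rightarrow> Bij (words X n)"
  shows "wr X n g h \<in> Bij (words X (Suc n))"
proof -
  let ?A = "X \<times> words X n" and ?B = "words X (Suc n)"
  have e: "bij_betw (\<lambda>w. (hd w, tl w)) ?B ?A"
    by (rule bij_betw_byWitness[where f' = "\<lambda>(x, v). x # v"]) (auto simp: words_Suc_iff)
  have e': "bij_betw (\<lambda>(x, v). x # v) ?A ?B"
    by (rule bij_betw_byWitness[where f' = "\<lambda>w. (hd w, tl w)"]) (auto simp: words_Suc_iff)
  have "bij_betw (\<lambda>(x, y). (g x, h x y)) ?A ?A"
    by (rule bij_betw_wreath_form) (use assms in \<open>auto simp: Bij_def Pi_def\<close>)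
  from bij_betw_trans[OF bij_betw_trans[OF e this] e'] show ?thesis
    by (simp add: Bij_def wr_def comp_def)
qed

text \<open>Multiplication is composition with the right factor acting first, so below
  \<open>x\<close> the left factor contributes its section at \<open>g' x\<close>.\<close>

lemma wr_mult:
  assumes "g \<in> Bij X" "h \<in> X \<rightarrow> Bij (words X n)" "g' \<in> Bij X" "h' \<in> X \<rightarrow> Bij (words X n)"
  shows "wr X n g h \<otimes>\<^bsub>BijGroup (words X (Suc n))\<^esub> wr X n g' h' =
    wr X n (g \<otimes>\<^bsub>BijGroup X\<^esub> g') (\<lambda>x. h (g' x) \<otimes>\<^bsub>BijGroup (words X n)\<^esub> h' x)"
proof (rule extensionalityI[of _ "words X (Suc n)"])
  fix w assume "w \<in> words X (Suc n)"
  then obtain x v where w: "w = x # v" "x \<in> X" "v \<in> words X n" by (auto simp: words_Suc_iff)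
  moreover have "g' x \<in> X" "h' x v \<in> words X n" "h (g' x) \<in> Bij (words X n)" "h' x \<in> Bij (words X n)"
    using assms w by (auto simp: Pi_def Bij_app)
  ultimately show "(wr X n g h \<otimes>\<^bsub>BijGroup (words X (Suc n))\<^esub> wr X n g' h') w =
    wr X n (g \<otimes>\<^bsub>BijGroup X\<^esub> g') (\<lambda>x. h (g' x) \<otimes>\<^bsub>BijGroup (words X n)\<^esub> h' x) w"
    using assms
    by (simp add: mult_BijGroup wr_in_Bij compose_eq) (simp add: wr_def Cons_in_words mult_BijGroup compose_eq)
qed (use assms in \<open>simp_all add: mult_BijGroup wr_in_Bij\<close>, simp add: wr_def)

lemma one_wr: "\<one>\<^bsub>BijGroup (words X (Suc n))\<^esub> = wr X n \<one>\<^bsub>BijGroup X\<^esub> (\<lambda>_. \<one>\<^bsub>BijGroup (words X n)\<^esub>)"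
  unfolding one_BijGroup wr_def by (intro restrict_ext) (auto simp: words_Suc_iff)

text \<open>The abstract group is replaced by its image \<open>P\<close> in the symmetric group of
  \<open>X\<close>, on which alone the wreath powers depend.\<close>

locale transitive_permutations =
  fixes X :: "'a set" and P :: "('a \<Rightarrow> 'a) set"
  assumes finite_X: "finite X" and X_nonempty: "X \<noteq> {}"
    and subgroup_P: "subgroup P (BijGroup X)"
    and transitive: "\<lbrakk>x \<in> X; y \<in> X\<rbrakk> \<Longrightarrow> \<exists>g\<in>P. g x = y"
begin

abbreviation "W \<equiv> wreath_power P X"
abbreviation "BX \<equiv> BijGroup X"
abbreviation "B n \<equiv> BijGroup (words X n)"

sublocale BX: group BX by (rule group_BijGroup)
sublocale B: group "B n" for n by (rule group_BijGroup)

lemma P_Bij: "g \<in> P \<Longrightarrow> g \<in> Bij X"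
  using subgroup.subset[OF subgroup_P] by (auto simp: carrier_BijGroup)

lemma subgroup_W: "subgroup (W n) (B n)"
  by (rule subgroup_wreath_power[OF subgroup_P])

lemma W_Bij: "w \<in> W n \<Longrightarrow> w \<in> Bij (words X n)"
  using subgroup.subset[OF subgroup_W] by (auto simp: carrier_BijGroup)

lemmas P_mult = subgroup.m_closed[OF subgroup_P]
lemmas P_one = subgroup.one_closed[OF subgroup_P]
lemmas W_mult = subgroup.m_closed[OF subgroup_W]
lemmas W_one = subgroup.one_closed[OF subgroup_W]

lemma P_app: "g \<in> P \<Longrightarrow> x \<in> X \<Longrightarrow> g x \<in> X"
  by (simp add: P_Bij Bij_app)

lemma finite_P: "finite P"
  using finite_subset[OF _ finite_Bij[OF finite_X]] P_Bij by blast

lemma finite_W: "finite (W n)"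
proof -
  have "finite (words X n)" unfolding words_def by (rule finite_lists_length_eq[OF finite_X])
  then show ?thesis using finite_subset[OF _ finite_Bij] W_Bij by blast
qed

lemma W_0: "W 0 = {\<one>\<^bsub>B 0\<^esub>}"
  by (simp add: wreath_power.simps one_BijGroup)

declare wreath_power.simps [simp del]

lemma W_Suc: "W (Suc n) = {wr X n g h | g h. g \<in> P \<and> h \<in> X \<rightarrow> W n}"
proof -
  have eq: "perm_wreath (W n) (words X n) P X =
      {\<lambda>(x, y)\<in>X \<times> words X n. (g x, h x y) | g h. g \<in> P \<and> h \<in> X \<rightarrow> W n}"
    by (rule perm_wreath_eq) (use P_Bij W_Bij in auto)
  have "(\<lambda>w\<in>words X (Suc n). case (\<lambda>(x, y)\<in>X \<times> words X n. (g x, h x y)) (hd w, tl w) of (x, v) \<Rightarrow> x # v)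
      = wr X n g h" for g h
    unfolding wr_def by (intro restrict_ext) (auto simp: words_Suc_iff)
  then show ?thesis
    unfolding wreath_power.simps eq by (force simp: image_iff)
qed

lemma wr_in_W: "g \<in> P \<Longrightarrow> h \<in> X \<rightarrow> W n \<Longrightarrow> wr X n g h \<in> W (Suc n)"
  unfolding W_Suc by blast

lemma wr_mult_P:
  assumes "g \<in> P" "h \<in> X \<rightarrow> W n" "g' \<in> P" "h' \<in> X \<rightarrow> W n"
  shows "wr X n g h \<otimes>\<^bsub>B (Suc n)\<^esub> wr X n g' h' = wr X n (g \<otimes>\<^bsub>BX\<^esub> g') (\<lambda>x. h (g' x) \<otimes>\<^bsub>B n\<^esub> h' x)"
  by (rule wr_mult) (use assms in \<open>auto intro!: P_Bij W_Bij\<close>)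

lemma P_carrier: "g \<in> P \<Longrightarrow> g \<in> carrier BX"
  by (simp add: carrier_BijGroup P_Bij)

lemma W_carrier: "w \<in> W n \<Longrightarrow> w \<in> carrier (B n)"
  by (simp add: carrier_BijGroup W_Bij)

section \<open>Rooted permutations, copies below a letter, and generation\<close>

definition rooted :: "nat \<Rightarrow> ('a \<Rightarrow> 'a) \<Rightarrow> 'a list \<Rightarrow> 'a list" where
  "rooted n g = wr X n g (\<lambda>_. \<one>\<^bsub>B n\<^esub>)"

definition base_at :: "nat \<Rightarrow> 'a \<Rightarrow> ('a list \<Rightarrow> 'a list) \<Rightarrow> 'a list \<Rightarrow> 'a list" where
  "base_at n x w = wr X n \<one>\<^bsub>BX\<^esub> (\<lambda>y. if y = x then w else \<one>\<^bsub>B n\<^esub>)"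

lemma rooted_in_W: "g \<in> P \<Longrightarrow> rooted n g \<in> W (Suc n)"
  unfolding rooted_def by (rule wr_in_W) (simp_all add: W_one)

lemma base_at_in_W: "w \<in> W n \<Longrightarrow> base_at n x w \<in> W (Suc n)"
  unfolding base_at_def by (rule wr_in_W) (simp_all add: W_one P_one)

lemma one_app: "x \<in> X \<Longrightarrow> \<one>\<^bsub>BX\<^esub> x = x"
  by (simp add: one_BijGroup)

lemma rooted_mult:
  "g \<in> P \<Longrightarrow> g' \<in> P \<Longrightarrow> rooted n (g \<otimes>\<^bsub>BX\<^esub> g') = rooted n g \<otimes>\<^bsub>B (Suc n)\<^esub> rooted n g'"
  unfolding rooted_def by (subst wr_mult_P) (simp_all add: W_one)

lemma base_at_mult:
  "w \<in> W n \<Longrightarrow> w' \<in> W n \<Longrightarrow>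
    base_at n x (w \<otimes>\<^bsub>B n\<^esub> w') = base_at n x w \<otimes>\<^bsub>B (Suc n)\<^esub> base_at n x w'"
  unfolding base_at_def
  by (subst wr_mult_P) (auto simp: W_one P_one one_app intro!: wr_cong)

lemma base_at_commute:
  "w \<in> W n \<Longrightarrow> w' \<in> W n \<Longrightarrow> x \<noteq> y \<Longrightarrow>
    base_at n x w \<otimes>\<^bsub>B (Suc n)\<^esub> base_at n y w' = base_at n y w' \<otimes>\<^bsub>B (Suc n)\<^esub> base_at n x w"
  unfolding base_at_def
  by (subst (1 2) wr_mult_P) (auto simp: W_one P_one one_app W_carrier intro!: wr_cong)

text \<open>Injectivity of \<open>g\<close> makes \<open>x\<close> the only letter sent to
  \<open>g x\<close>; hence conjugation by the rooted \<open>g\<close> moves the copy of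
  \<open>w\<close> below \<open>x\<close> to the copy below \<open>g x\<close>.\<close>

lemma rooted_base_at:
  assumes "g \<in> P" "w \<in> W n" "x \<in> X"
  shows "rooted n g \<otimes>\<^bsub>B (Suc n)\<^esub> base_at n x w = base_at n (g x) w \<otimes>\<^bsub>B (Suc n)\<^esub> rooted n g"
proof -
  have "inj_on g X" using P_Bij[OF assms(1)] by (simp add: Bij_def bij_betw_def)
  then show ?thesis
    unfolding base_at_def rooted_def using assms
    by (subst (1 2) wr_mult_P)
       (auto simp: W_one P_one one_app W_carrier P_carrier inj_on_eq_iff intro!: wr_cong)
qed

lemma base_at_translate:
  assumes K: "subgroup K (B (Suc n))" and "rooted n ` P \<subseteq> K"
    and "base_at n x w \<in> K" "w \<in> W n" "x \<in> X" "y \<in> X"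
  shows "base_at n y w \<in> K"
proof -
  obtain g where g: "g \<in> P" "g x = y" using transitive assms by blast
  have r: "rooted n g \<in> K" using assms g by blast
  have "base_at n y w = rooted n g \<otimes>\<^bsub>B (Suc n)\<^esub> base_at n x w \<otimes>\<^bsub>B (Suc n)\<^esub> inv\<^bsub>B (Suc n)\<^esub> rooted n g"
    using rooted_base_at[OF g(1) assms(4,5)] g
    by (simp add: B.inv_solve_right W_carrier[OF rooted_in_W] W_carrier[OF base_at_in_W] assms)
  then show ?thesis
    using subgroup.m_closed[OF K] subgroup.m_inv_closed[OF K] r assms(3) by simp
qed

text \<open>By transitivity, conjugation puts the copies of \<open>W n\<close> below all letters
  into \<open>K\<close>. As \<open>X\<close> is finite, they multiply up to the whole base group,
  and the rooted permutations supply the rest.\<close>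

lemma W_Suc_subset:
  assumes K: "subgroup K (B (Suc n))" and r: "rooted n ` P \<subseteq> K"
    and b: "base_at n x ` W n \<subseteq> K" and x: "x \<in> X"
  shows "W (Suc n) \<subseteq> K"
proof
  fix f assume "f \<in> W (Suc n)"
  then obtain g h where f: "f = wr X n g h" "g \<in> P" "h \<in> X \<rightarrow> W n" by (auto simp: W_Suc)
  have b': "base_at n y w \<in> K" if "w \<in> W n" "y \<in> X" for w y
    using base_at_translate[OF K r _ that(1) x that(2)] b that by blast
  have "wr X n \<one>\<^bsub>BX\<^esub> (\<lambda>y. if y \<in> F then h y else \<one>\<^bsub>B n\<^esub>) \<in> K" if "F \<subseteq> X" for F
    using finite_subset[OF that finite_X] that
  proof (induction F rule: finite_induct)
    case empty
    then show ?case using subgroup.one_closed[OF K] by (simp add: one_wr)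
  next
    case (insert y F)
    have "wr X n \<one>\<^bsub>BX\<^esub> (\<lambda>z. if z \<in> insert y F then h z else \<one>\<^bsub>B n\<^esub>) =
        base_at n y (h y) \<otimes>\<^bsub>B (Suc n)\<^esub> wr X n \<one>\<^bsub>BX\<^esub> (\<lambda>z. if z \<in> F then h z else \<one>\<^bsub>B n\<^esub>)"
      unfolding base_at_def using insert f
      by (subst wr_mult_P) (auto simp: W_one P_one one_app W_carrier Pi_def intro!: wr_cong)
    then show ?case
      using insert b'[of "h y" y] f subgroup.m_closed[OF K] by auto
  qed
  from this[OF order_refl] have "wr X n \<one>\<^bsub>BX\<^esub> h \<in> K"
    by (simp cong: wr_cong)
  moreover have "f = rooted n g \<otimes>\<^bsub>B (Suc n)\<^esub> wr X n \<one>\<^bsub>BX\<^esub> h"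
    unfolding rooted_def f(1) using f
    by (subst wr_mult_P) (auto simp: W_one P_one one_app W_carrier P_carrier Pi_def intro!: wr_cong)
  ultimately show "f \<in> K" using r f subgroup.m_closed[OF K] by auto
qed

lemma base_at_group_hom: "group_hom (B n\<lparr>carrier := W n\<rparr>) (B (Suc n)) (base_at n x)"
  by (intro group_hom.intro group_hom_axioms.intro B.subgroup_imp_group subgroup_W B.is_group)
     (auto simp: hom_def base_at_mult W_carrier[OF base_at_in_W])

lemma rooted_one: "rooted n \<one>\<^bsub>BX\<^esub> = \<one>\<^bsub>B (Suc n)\<^esub>"
  by (simp add: rooted_def one_wr)

lemma base_at_generate:
  assumes K: "subgroup K (B (Suc n))" and "T \<subseteq> W n" "base_at n x ` T \<subseteq> K" "generate (B n) T = W n"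
  shows "base_at n x ` W n \<subseteq> K"
proof -
  interpret h: group_hom "B n\<lparr>carrier := W n\<rparr>" "B (Suc n)" "base_at n x"
    by (rule base_at_group_hom)
  have "base_at n x ` W n = generate (B (Suc n)) (base_at n x ` T)"
    using h.generate_img[of T] B.generate_consistent[OF assms(2) subgroup_W] assms(2,4) by simp
  also have "\<dots> \<subseteq> K" by (rule B.generate_subgroup_incl[OF assms(3) K])
  finally show ?thesis .
qed

lemma generate_eq_W:
  assumes "S \<subseteq> W n" "W n \<subseteq> generate (B n) S"
  shows "generate (B n) S = W n"
  using B.generate_subgroup_incl[OF assms(1) subgroup_W] assms(2) by blast

lemma min_generators_W_le:
  assumes "S \<subseteq> W n" "finite S" "generate (B n) S = W n"
  shows "min_generators (B n\<lparr>carrier := W n\<rparr>) \<le> card S"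
  using assms B.generate_consistent[OF assms(1) subgroup_W] by (intro min_generators_le) auto


section \<open>The linear upper bound\<close>

text \<open>Each new level costs one rooted copy of \<open>P\<close>. Leaving out the identity makes
  the bound 0 for trivial \<open>P\<close>, which the perfect case on at most two points relies
  on.\<close>

lemma linear_generators:
  "\<exists>S\<subseteq>W n. finite S \<and> card S \<le> n * card (P - {\<one>\<^bsub>BX\<^esub>}) \<and> generate (B n) S = W n"
proof (induction n)
  case 0
  have "generate (B 0) {} = W 0" by (simp only: W_0 B.generate_empty)
  then show ?case by (intro exI[of _ "{}"]) simp
next
  case (Suc n)
  then obtain S where S: "S \<subseteq> W n" "finite S" "card S \<le> n * card (P - {\<one>\<^bsub>BX\<^esub>})" "generate (B n) S = W n"
    by blast
  obtain x where x: "x \<in> X" using X_nonempty by blast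
  let ?T = "rooted n ` (P - {\<one>\<^bsub>BX\<^esub>}) \<union> base_at n x ` S"
  have T: "?T \<subseteq> W (Suc n)" using S rooted_in_W base_at_in_W by blast
  have K: "subgroup (generate (B (Suc n)) ?T) (B (Suc n))"
    by (rule B.generate_is_subgroup) (use T W_carrier in blast)
  have "rooted n ` P \<subseteq> generate (B (Suc n)) ?T"
  proof (rule image_subsetI)
    fix g assume "g \<in> P"
    then show "rooted n g \<in> generate (B (Suc n)) ?T"
      by (cases "g = \<one>\<^bsub>BX\<^esub>") (auto simp: rooted_one intro: generate.one generate.incl)
  qed
  moreover have "base_at n x ` W n \<subseteq> generate (B (Suc n)) ?T"
    by (rule base_at_generate[OF K S(1) _ S(4)]) (auto intro: generate.incl)
  ultimately have "generate (B (Suc n)) ?T = W (Suc n)"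
    by (intro generate_eq_W T W_Suc_subset[OF K _ _ x])
  moreover have "card ?T \<le> Suc n * card (P - {\<one>\<^bsub>BX\<^esub>})"
    using S finite_P card_Un_le[of "rooted n ` (P - {\<one>\<^bsub>BX\<^esub>})" "base_at n x ` S"]
      card_image_le[of "P - {\<one>\<^bsub>BX\<^esub>}" "rooted n"] card_image_le[of S "base_at n x"] by simp
  ultimately show ?case using T S finite_P by (intro exI[of _ ?T]) simp
qed

lemma min_generators_W_linear:
  "min_generators (B n\<lparr>carrier := W n\<rparr>) \<le> n * card (P - {\<one>\<^bsub>BX\<^esub>})"
proof -
  obtain S where "S \<subseteq> W n" "finite S" "card S \<le> n * card (P - {\<one>\<^bsub>BX\<^esub>})" "generate (B n) S = W n"
    using linear_generators by blast
  with min_generators_W_le show ?thesis by (meson order_trans)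
qed


section \<open>Bounded generation for perfect groups\<close>

text \<open>These are the elements a_h of the overview. The trivial value on the empty word spares
  the recursion of \<open>spine\<close> a special case.\<close>

primrec top_perm :: "nat \<Rightarrow> ('a \<Rightarrow> 'a) \<Rightarrow> 'a list \<Rightarrow> 'a list" where
  "top_perm 0 g = \<one>\<^bsub>B 0\<^esub>"
| "top_perm (Suc n) g = rooted n g"

text \<open>In the overview b_h is \<open>spine x y n h\<close> and c_h is
  \<open>spine z y n h\<close>. The labels sit at the vertices y, xy, xxy, ... next to the ray
  xxx...\<close>

primrec spine :: "'a \<Rightarrow> 'a \<Rightarrow> nat \<Rightarrow> ('a \<Rightarrow> 'a) \<Rightarrow> 'a list \<Rightarrow> 'a list" where
  "spine x y 0 g = \<one>\<^bsub>B 0\<^esub>"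
| "spine x y (Suc n) g = base_at n x (spine x y n g) \<otimes>\<^bsub>B (Suc n)\<^esub> base_at n y (top_perm n g)"

lemma top_perm_in_W: "g \<in> P \<Longrightarrow> top_perm n g \<in> W n"
  by (cases n) (simp_all add: W_one rooted_in_W)

lemma spine_in_W: "g \<in> P \<Longrightarrow> spine x y n g \<in> W n"
  by (induction n) (simp_all add: W_one W_mult base_at_in_W top_perm_in_W)

lemma top_perm_mult:
  "g \<in> P \<Longrightarrow> g' \<in> P \<Longrightarrow> top_perm n (g \<otimes>\<^bsub>BX\<^esub> g') = top_perm n g \<otimes>\<^bsub>B n\<^esub> top_perm n g'"
  by (cases n) (simp_all add: rooted_mult)

lemma base_at_top_perm_group_hom:
  "group_hom (BX\<lparr>carrier := P\<rparr>) (B (Suc n)) (\<lambda>g. base_at n x (top_perm n g))"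
  by (intro group_hom.intro group_hom_axioms.intro BX.subgroup_imp_group subgroup_P B.is_group)
     (auto simp: hom_def base_at_mult top_perm_mult top_perm_in_W W_carrier[OF base_at_in_W])

text \<open>Factors below distinct letters commute, so only the two factors below \<open>y\<close>
  survive in the commutator.\<close>

lemma spine_commutator:
  assumes "x \<noteq> y" "z \<noteq> y" "x \<noteq> z" and g: "g \<in> P" "h \<in> P"
  shows "spine x y (Suc n) g \<otimes>\<^bsub>B (Suc n)\<^esub> spine z y (Suc n) h \<otimes>\<^bsub>B (Suc n)\<^esub>
      inv\<^bsub>B (Suc n)\<^esub> spine x y (Suc n) g \<otimes>\<^bsub>B (Suc n)\<^esub> inv\<^bsub>B (Suc n)\<^esub> spine z y (Suc n) h =
    base_at n y (top_perm n g) \<otimes>\<^bsub>B (Suc n)\<^esub> base_at n y (top_perm n h) \<otimes>\<^bsub>B (Suc n)\<^esub>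
      inv\<^bsub>B (Suc n)\<^esub> base_at n y (top_perm n g) \<otimes>\<^bsub>B (Suc n)\<^esub> inv\<^bsub>B (Suc n)\<^esub> base_at n y (top_perm n h)"
  unfolding spine.simps
  by (rule B.commutator_of_commuting_products)
     (use assms in \<open>auto intro!: W_carrier base_at_in_W base_at_commute spine_in_W top_perm_in_W\<close>)

lemma perfect_generators:
  assumes perfect: "derived BX P = P"
    and xyz: "x \<in> X" "y \<in> X" "z \<in> X" "x \<noteq> y" "z \<noteq> y" "x \<noteq> z"
  shows "generate (B n) (top_perm n ` P \<union> spine x y n ` P \<union> spine z y n ` P) = W n"
proof (induction n)
  case 0
  have "top_perm 0 ` P \<union> spine x y 0 ` P \<union> spine z y 0 ` P = {\<one>\<^bsub>B 0\<^esub>}"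
    using P_one by auto
  then show ?case by (simp only: W_0 B.generate_one)
next
  case (Suc n)
  let ?S = "\<lambda>n. top_perm n ` P \<union> spine x y n ` P \<union> spine z y n ` P"
  let ?K = "generate (B (Suc n)) (?S (Suc n))"
  let ?\<psi> = "\<lambda>g. base_at n y (top_perm n g)"
  have S: "?S n \<subseteq> W n" for n
    using top_perm_in_W spine_in_W by blast
  have K: "subgroup ?K (B (Suc n))"
    by (rule B.generate_is_subgroup) (use S[of "Suc n"] W_carrier in blast)
  have incl: "?S (Suc n) \<subseteq> ?K" by (blast intro: generate.incl)
  then have r: "rooted n ` P \<subseteq> ?K" by auto
  have sp: "spine x y (Suc n) g \<in> ?K" "spine z y (Suc n) g \<in> ?K" if "g \<in> P" for g
    using incl that by blast+
  interpret \<psi>: group_hom "BX\<lparr>carrier := P\<rparr>" "B (Suc n)" ?\<psi>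
    by (rule base_at_top_perm_group_hom)
  \<comment> \<open>Commutators of the spine generators realise all commutators of the rooted copies
    below \<open>y\<close>.\<close>
  have "derived_set (B (Suc n)) (?\<psi> ` P) \<subseteq> ?K"
  proof clarify
    fix g h assume gh: "g \<in> P" "h \<in> P"
    show "?\<psi> g \<otimes>\<^bsub>B (Suc n)\<^esub> ?\<psi> h \<otimes>\<^bsub>B (Suc n)\<^esub> inv\<^bsub>B (Suc n)\<^esub> ?\<psi> g \<otimes>\<^bsub>B (Suc n)\<^esub> inv\<^bsub>B (Suc n)\<^esub> ?\<psi> h \<in> ?K"
      unfolding spine_commutator[OF xyz(4-6) gh, symmetric]
      by (intro subgroup.m_closed[OF K] subgroup.m_inv_closed[OF K] sp gh)
  qed
  then have "derived (B (Suc n)) (?\<psi> ` P) \<subseteq> ?K"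
    unfolding derived_def by (rule B.generate_subgroup_incl[OF _ K])
  \<comment> \<open>Perfectness passes through the homomorphism: the image of \<open>P\<close> is
    its own derived subgroup.\<close>
  moreover have "derived (B (Suc n)) (?\<psi> ` P) = ?\<psi> ` P"
    using \<psi>.derived_img[of P] BX.derived_consistent[OF _ subgroup_P, of P] perfect by simp
  ultimately have \<psi>: "base_at n y (top_perm n g) \<in> ?K" if "g \<in> P" for g
    using that by blast
  \<comment> \<open>The factor below \<open>y\<close>, now known to lie in \<open>?K\<close>, is
    divided off; \<open>u\<close> will be \<open>x\<close> or \<open>z\<close>.\<close>
  have strip: "base_at n u (spine u y n g) \<in> ?K"
    if "g \<in> P" "spine u y (Suc n) g \<in> ?K" for u g
  proof -
    have "base_at n u (spine u y n g) = spine u y (Suc n) g \<otimes>\<^bsub>B (Suc n)\<^esub> inv\<^bsub>B (Suc n)\<^esub> ?\<psi> g"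
      using that W_carrier[OF base_at_in_W] spine_in_W top_perm_in_W
      by (simp add: B.inv_solve_right)
    then show ?thesis
      using that \<psi> subgroup.m_closed[OF K] subgroup.m_inv_closed[OF K] by metis
  qed
  \<comment> \<open>The three families of level \<open>n\<close> have been found below
    \<open>y\<close>, \<open>x\<close> and \<open>z\<close> respectively; translation brings them
    all below \<open>x\<close>, where the induction hypothesis applies.\<close>
  have "base_at n x ` ?S n \<subseteq> ?K"
  proof (intro image_subsetI)
    fix w assume "w \<in> ?S n"
    then obtain g where g: "g \<in> P" and "w = top_perm n g \<or> w = spine x y n g \<or> w = spine z y n g"
      by blast
    then consider "w = top_perm n g" | "w = spine x y n g" | "w = spine z y n g" by blast
    then show "base_at n x w \<in> ?K"
    proof cases
      case 1
      then show ?thesis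
        using base_at_translate[OF K r \<psi>[OF g] top_perm_in_W[OF g]] xyz by blast
    next
      case 2
      then show ?thesis using strip sp g by blast
    next
      case 3
      then show ?thesis
        using base_at_translate[OF K r strip[OF g sp(2)[OF g]] spine_in_W[OF g]] xyz by blast
    qed
  qed
  then have "base_at n x ` W n \<subseteq> ?K"
    using base_at_generate[OF K S] Suc.IH by blast
  then show ?case
    by (intro generate_eq_W S W_Suc_subset[OF K r _ xyz(1)])
qed

text \<open>On at most two points the full symmetric group is commutative, so every derived subgroup
  is trivial.\<close>

lemma perfect_le_two_points:
  assumes perfect: "derived BX P = P"
    and two: "\<And>x y z. x \<in> X \<Longrightarrow> y \<in> X \<Longrightarrow> z \<in> X \<Longrightarrow> x = y \<or> y = z \<or> x = z"
  shows "P = {\<one>\<^bsub>BX\<^esub>}"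
proof -
  have "f (g x) = g (f x)" if fg: "f \<in> Bij X" "g \<in> Bij X" and x: "x \<in> X" for f g x
  proof -
    have inj: "f a = f b \<longleftrightarrow> a = b" "g a = g b \<longleftrightarrow> a = b" if "a \<in> X" "b \<in> X" for a b
      using fg that by (auto simp: Bij_def bij_betw_def inj_on_eq_iff)
    have cl: "f a \<in> X" "g a \<in> X" if "a \<in> X" for a
      using fg that by (auto simp: Bij_app)
    show ?thesis
      using two[of x "f x" "g x"] two[of x "g x" "f (g x)"] two[of x "f x" "g (f x)"]
        two[of x "f x" "f (f x)"] two[of x "g x" "g (g x)"]
        inj[of x "g x"] inj[of x "f x"] cl x by metis
  qed
  then have "f \<otimes>\<^bsub>BX\<^esub> g = g \<otimes>\<^bsub>BX\<^esub> f" if "f \<in> Bij X" "g \<in> Bij X" for f g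
    using that by (simp add: mult_BijGroup compose_def cong: restrict_cong)
  then have "comm_group BX"
    by (intro BX.group_comm_groupI) (simp add: carrier_BijGroup)
  from comm_group.derived_eq_singleton[OF this, of P] show ?thesis
    using perfect P_carrier by blast
qed

lemma min_generators_W_perfect:
  assumes "derived BX P = P"
  shows "min_generators (B n\<lparr>carrier := W n\<rparr>) \<le> 3 * card P"
proof (cases "\<exists>x\<in>X. \<exists>y\<in>X. \<exists>z\<in>X. x \<noteq> y \<and> z \<noteq> y \<and> x \<noteq> z")
  case True
  then obtain x y z where xyz: "x \<in> X" "y \<in> X" "z \<in> X" "x \<noteq> y" "z \<noteq> y" "x \<noteq> z" by blast
  let ?S = "top_perm n ` P \<union> spine x y n ` P \<union> spine z y n ` P"
  have "min_generators (B n\<lparr>carrier := W n\<rparr>) \<le> card ?S"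
    by (rule min_generators_W_le[OF _ _ perfect_generators[OF assms xyz]])
       (use finite_P top_perm_in_W spine_in_W in auto)
  also have "\<dots> \<le> 3 * card P"
    using card_Un_le[of "top_perm n ` P \<union> spine x y n ` P" "spine z y n ` P"]
      card_Un_le[of "top_perm n ` P" "spine x y n ` P"]
      card_image_le[OF finite_P, of "top_perm n"] card_image_le[OF finite_P, of "spine x y n"]
      card_image_le[OF finite_P, of "spine z y n"] by linarith
  finally show ?thesis .
next
  case False
  then have "P = {\<one>\<^bsub>BX\<^esub>}"
    by (intro perfect_le_two_points assms) blast
  \<comment> \<open>Without the identity \<open>P\<close> is empty here, so the linear bound is
    0.\<close>
  then show ?thesis using min_generators_W_linear[of n] by simp
qed


section \<open>The linear lower bound\<close>

text \<open>For \<open>f\<close> acting on words of length \<open>n\<close>, this is the product over all words \<open>u\<close> of length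
  \<open>i < n\<close> of the values of \<open>\<alpha>\<close> at the permutation which \<open>f\<close> induces below \<open>u\<close>.\<close>

primrec level_hom :: "('c, 'd) monoid_scheme \<Rightarrow> (('a \<Rightarrow> 'a) \<Rightarrow> 'c) \<Rightarrow> nat \<Rightarrow> nat \<Rightarrow>
    ('a list \<Rightarrow> 'a list) \<Rightarrow> 'c" where
  "level_hom A \<alpha> 0 n f = \<alpha> (root_part X (n - 1) f)"
| "level_hom A \<alpha> (Suc i) n f =
    finprod A (\<lambda>x. level_hom A \<alpha> i (n - 1) (word_section X (n - 1) f x)) X"

text \<open>To be instantiated with the quotient \<open>P/P'\<close> and the quotient map.\<close>

context
  fixes A :: "('c, 'd) monoid_scheme" and \<alpha>
  assumes A: "comm_group A" and \<alpha>: "\<alpha> \<in> hom (BX\<lparr>carrier := P\<rparr>) A"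
begin

interpretation A: comm_group A by (rule A)

lemma level_hom_0_wr:
  "g \<in> P \<Longrightarrow> level_hom A \<alpha> 0 (Suc n) (wr X n g h) = \<alpha> g"
  by (simp add: root_part_wr P_Bij)

lemma level_hom_Suc_wr:
  assumes "\<And>w. w \<in> W n \<Longrightarrow> level_hom A \<alpha> i n w \<in> carrier A" and "h \<in> X \<rightarrow> W n"
  shows "level_hom A \<alpha> (Suc i) (Suc n) (wr X n g h) = finprod A (\<lambda>x. level_hom A \<alpha> i n (h x)) X"
  using assms by (auto intro!: A.finprod_cong' simp: word_section_wr W_Bij Pi_iff)

text \<open>In a product the sections of the left factor appear permuted by the root permutation of
  the right factor; a product over all letters in a commutative group is insensitive to
  this.\<close>

lemma level_hom_hom: "i < n \<Longrightarrow> level_hom A \<alpha> i n \<in> hom (B n\<lparr>carrier := W n\<rparr>) A"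
proof (induction i arbitrary: n)
  case 0
  then obtain m where n: "n = Suc m" by (cases n) auto
  show ?case
  proof (rule homI)
    fix f assume "f \<in> carrier (B n\<lparr>carrier := W n\<rparr>)"
    then obtain g h where "f = wr X m g h" "g \<in> P" by (auto simp: n W_Suc)
    then show "level_hom A \<alpha> 0 n f \<in> carrier A"
      using \<alpha> unfolding n by (simp only: level_hom_0_wr) (auto simp: hom_def)
  next
    fix f f' assume "f \<in> carrier (B n\<lparr>carrier := W n\<rparr>)" "f' \<in> carrier (B n\<lparr>carrier := W n\<rparr>)"
    then obtain g h g' h' where f: "f = wr X m g h" "g \<in> P" "h \<in> X \<rightarrow> W m"
      "f' = wr X m g' h'" "g' \<in> P" "h' \<in> X \<rightarrow> W m" by (auto simp: n W_Suc)
    have "level_hom A \<alpha> 0 n (f \<otimes>\<^bsub>B n\<^esub> f') = \<alpha> (g \<otimes>\<^bsub>BX\<^esub> g')"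
      unfolding n f(1,4) wr_mult_P[OF f(2,3,5,6)] by (rule level_hom_0_wr[OF P_mult[OF f(2,5)]])
    also have "\<dots> = \<alpha> g \<otimes>\<^bsub>A\<^esub> \<alpha> g'" using hom_mult[OF \<alpha>] f by simp
    finally show "level_hom A \<alpha> 0 n (f \<otimes>\<^bsub>B n\<lparr>carrier := W n\<rparr>\<^esub> f') =
        level_hom A \<alpha> 0 n f \<otimes>\<^bsub>A\<^esub> level_hom A \<alpha> 0 n f'"
      using f by (simp add: n root_part_wr P_Bij)
  qed
next
  case (Suc i)
  then obtain m where n: "n = Suc m" and "i < m" by (cases n) auto
  let ?\<theta> = "level_hom A \<alpha> i m"
  have IH: "?\<theta> \<in> hom (B m\<lparr>carrier := W m\<rparr>) A" using Suc.IH \<open>i < m\<close> .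
  then have cl: "?\<theta> w \<in> carrier A" if "w \<in> W m" for w
    using that by (auto simp: hom_def)
  show ?case
  proof (rule homI)
    fix f assume "f \<in> carrier (B n\<lparr>carrier := W n\<rparr>)"
    then obtain g h where "f = wr X m g h" "g \<in> P" "h \<in> X \<rightarrow> W m" by (auto simp: n W_Suc)
    then show "level_hom A \<alpha> (Suc i) n f \<in> carrier A"
      unfolding n by (simp only: level_hom_Suc_wr cl) (auto intro!: A.finprod_closed cl)
  next
    fix f f' assume "f \<in> carrier (B n\<lparr>carrier := W n\<rparr>)" "f' \<in> carrier (B n\<lparr>carrier := W n\<rparr>)"
    then obtain g h g' h' where f: "f = wr X m g h" "g \<in> P" "h \<in> X \<rightarrow> W m"
      "f' = wr X m g' h'" "g' \<in> P" "h' \<in> X \<rightarrow> W m" by (auto simp: n W_Suc)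
    have hg: "(\<lambda>x. h (g' x)) \<in> X \<rightarrow> W m" using f P_app by auto
    have g': "inj_on g' X" "g' ` X = X" using P_Bij[OF f(5)] by (auto simp: Bij_def bij_betw_def)
    have "level_hom A \<alpha> (Suc i) n (f \<otimes>\<^bsub>B n\<^esub> f') =
        finprod A (\<lambda>x. ?\<theta> (h (g' x) \<otimes>\<^bsub>B m\<^esub> h' x)) X"
      unfolding n f(1,4) wr_mult_P[OF f(2,3,5,6)]
      by (rule level_hom_Suc_wr) (use cl hg f in \<open>auto intro!: W_mult\<close>)
    also have "\<dots> = finprod A (\<lambda>x. ?\<theta> (h (g' x)) \<otimes>\<^bsub>A\<^esub> ?\<theta> (h' x)) X"
      using IH hg f cl by (intro A.finprod_cong') (auto simp: hom_def Pi_iff)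
    also have "\<dots> = finprod A (\<lambda>x. ?\<theta> (h (g' x))) X \<otimes>\<^bsub>A\<^esub> finprod A (\<lambda>x. ?\<theta> (h' x)) X"
      using hg f cl by (intro A.finprod_multf) auto
    also have "finprod A (\<lambda>x. ?\<theta> (h (g' x))) X = finprod A (\<lambda>x. ?\<theta> (h x)) X"
    proof -
      have "(\<lambda>x. ?\<theta> (h x)) \<in> X \<rightarrow> carrier A" using f cl by auto
      with A.finprod_reindex[of "\<lambda>x. ?\<theta> (h x)" g' X] g' show ?thesis by simp
    qed
    finally show "level_hom A \<alpha> (Suc i) n (f \<otimes>\<^bsub>B n\<lparr>carrier := W n\<rparr>\<^esub> f') =
        level_hom A \<alpha> (Suc i) n f \<otimes>\<^bsub>A\<^esub> level_hom A \<alpha> (Suc i) n f'"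
      using level_hom_Suc_wr[OF cl f(3), of g] level_hom_Suc_wr[OF cl f(6), of g'] f
      by (simp add: n)
  qed
qed

lemma level_hom_closed: "i < n \<Longrightarrow> w \<in> W n \<Longrightarrow> level_hom A \<alpha> i n w \<in> carrier A"
  using level_hom_hom[of i n] by (auto simp: hom_def)

lemma level_hom_one: "i < n \<Longrightarrow> level_hom A \<alpha> i n \<one>\<^bsub>B n\<^esub> = \<one>\<^bsub>A\<^esub>"
  using hom_one[OF level_hom_hom B.subgroup_imp_group[OF subgroup_W] A.is_group] by simp

text \<open>The levels can be prescribed independently: the root label realises \<open>t 0\<close>,
  and a single section, trivial below the other letters, realises the shifted tuple.\<close>

lemma level_hom_surj:
  assumes surj: "\<alpha> ` P = carrier A" and t: "\<And>i. i < n \<Longrightarrow> t i \<in> carrier A"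
  shows "\<exists>w\<in>W n. \<forall>i<n. level_hom A \<alpha> i n w = t i"
  using t
proof (induction n arbitrary: t)
  case 0
  then show ?case using W_one by auto
next
  case (Suc n)
  obtain g where g: "g \<in> P" "\<alpha> g = t 0" using surj Suc.prems[of 0] by force
  obtain w where w: "w \<in> W n" "\<And>i. i < n \<Longrightarrow> level_hom A \<alpha> i n w = t (Suc i)"
    using Suc.IH[of "\<lambda>i. t (Suc i)"] Suc.prems by auto
  obtain x where x: "x \<in> X" using X_nonempty by blast
  let ?h = "\<lambda>y. if y = x then w else \<one>\<^bsub>B n\<^esub>"
  have h: "?h \<in> X \<rightarrow> W n" using w W_one by auto
  have "level_hom A \<alpha> i (Suc n) (wr X n g ?h) = t i" if i: "i < Suc n" for i
  proof (cases i)
    case 0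
    then show ?thesis using level_hom_0_wr g by simp
  next
    case (Suc j)
    then have j: "j < n" using i by simp
    have "level_hom A \<alpha> i (Suc n) (wr X n g ?h) = finprod A (\<lambda>y. level_hom A \<alpha> j n (?h y)) X"
      unfolding Suc by (rule level_hom_Suc_wr[OF level_hom_closed[OF j] h])
    also have "\<dots> = finprod A (\<lambda>y. if y = x then t (Suc j) else \<one>\<^bsub>A\<^esub>) X"
      using w(2)[OF j] level_hom_one[OF j] Suc.prems[of "Suc j"] j
      by (intro A.finprod_cong') auto
    also have "\<dots> = t (Suc j)"
      using A.finprod_singleton_swap[OF x finite_X, of "\<lambda>_. t (Suc j)"] Suc.prems[of "Suc j"] j by auto
    finally show ?thesis using Suc by simp
  qed
  then show ?case using wr_in_W[OF g(1) h] by blast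
qed

text \<open>The wreath power maps onto all |A|^n tuples, while k generators reach at most |A|^k of
  them.\<close>

lemma le_min_generators_W:
  assumes surj: "\<alpha> ` P = carrier A" and "card (carrier A) \<ge> 2"
  shows "n \<le> min_generators (B n\<lparr>carrier := W n\<rparr>)"
proof -
  let ?G = "B n\<lparr>carrier := W n\<rparr>"
  have fin: "finite (carrier A)" using surj finite_P by (metis finite_imageI)
  \<comment> \<open>Some finite generating set must be exhibited before the minimum is known to be
    attained.\<close>
  obtain S where S: "S \<subseteq> W n" "finite S" "generate (B n) S = W n"
    using linear_generators[of n] by blast
  then obtain T where T: "T \<subseteq> carrier ?G" "finite T" "card T = min_generators ?G"
      "generate ?G T = carrier ?G"
    using min_generators_attained[of S ?G] B.generate_consistent[OF S(1) subgroup_W] by auto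
  have "{..<n} \<rightarrow>\<^sub>E carrier A \<subseteq> (\<lambda>w. \<lambda>i\<in>{..<n}. level_hom A \<alpha> i n w) ` W n"
  proof
    fix t assume t: "t \<in> {..<n} \<rightarrow>\<^sub>E carrier A"
    then obtain w where "w \<in> W n" "\<forall>i<n. level_hom A \<alpha> i n w = t i"
      using level_hom_surj[OF surj, of n t] by auto
    moreover from this t have "t = (\<lambda>i\<in>{..<n}. level_hom A \<alpha> i n w)"
      by (intro extensionalityI[of _ "{..<n}"]) (auto simp: PiE_def)
    ultimately show "t \<in> (\<lambda>w. \<lambda>i\<in>{..<n}. level_hom A \<alpha> i n w) ` W n" by blast
  qed
  moreover note finite_W
  ultimately have "card ({..<n} \<rightarrow>\<^sub>E carrier A) \<le> card ((\<lambda>w. \<lambda>i\<in>{..<n}. level_hom A \<alpha> i n w) ` W n)"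
    by (intro card_mono finite_imageI)
  also have "\<dots> \<le> card (carrier A) ^ card T"
    using A.card_hom_tuples_le[OF B.subgroup_imp_group[OF subgroup_W] fin T(1,2,4),
      of "{..<n}" "\<lambda>i. level_hom A \<alpha> i n"] level_hom_hom by simp
  finally have "card (carrier A) ^ n \<le> card (carrier A) ^ card T"
    by (simp add: card_PiE)
  then have "n \<le> card T" using assms(2) by (simp add: power_increasing_iff)
  then show ?thesis using T by simp
qed

end

text \<open>An element outside the proper subgroup \<open>P'\<close> yields a second coset, so the
  abelianization \<open>P/P'\<close> has order at least 2.\<close>

lemma le_min_generators_W_not_perfect:
  assumes "derived BX P \<noteq> P"
  shows "n \<le> min_generators (B n\<lparr>carrier := W n\<rparr>)"
proof -
  let ?G = "BX\<lparr>carrier := P\<rparr>" and ?D = "derived BX P"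
  interpret G: group ?G by (rule BX.subgroup_imp_group[OF subgroup_P])
  interpret D: normal ?D ?G by (rule BX.derived_subgroup_is_normal[OF subgroup_P])
  have carrier_A: "carrier (?G Mod ?D) = (\<lambda>a. ?D #>\<^bsub>?G\<^esub> a) ` P"
    by (auto simp: FactGroup_def RCOSETS_def)
  have "?D \<subseteq> P" using D.subset by simp
  then obtain g where g: "g \<in> P" "g \<notin> ?D" using assms by blast
  have "?D #>\<^bsub>?G\<^esub> \<one>\<^bsub>?G\<^esub> = ?D" by (rule G.coset_mult_one[OF D.subset])
  moreover have "g \<in> ?D #>\<^bsub>?G\<^esub> g" using G.rcos_self[OF _ D.subgroup_axioms] g by simp
  ultimately have "?D #>\<^bsub>?G\<^esub> \<one>\<^bsub>?G\<^esub> \<noteq> ?D #>\<^bsub>?G\<^esub> g" using g by metis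
  then have "card {?D #>\<^bsub>?G\<^esub> \<one>\<^bsub>?G\<^esub>, ?D #>\<^bsub>?G\<^esub> g} = 2" by (simp add: card_insert_if)
  moreover have "card {?D #>\<^bsub>?G\<^esub> \<one>\<^bsub>?G\<^esub>, ?D #>\<^bsub>?G\<^esub> g} \<le> card (carrier (?G Mod ?D))"
    unfolding carrier_A using g P_one finite_P by (intro card_mono) auto
  ultimately show ?thesis
    using le_min_generators_W[OF BX.derived_quot_of_subgroup_is_comm_group[OF subgroup_P]
      D.r_coset_hom_Mod carrier_A[symmetric]] by simp
qed

end

section \<open>From the abstract action to its permutation group\<close>

theorem corollary4:
  fixes H :: "('g, 'm) monoid_scheme" and X :: "'a set" and \<phi> :: "'g \<Rightarrow> 'a \<Rightarrow> 'a"
  assumes "finite_transitive_permutation_group H X \<phi>"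
  shows "(perfect_group H \<longrightarrow> (\<exists>B. \<forall>n\<ge>1. d_wr H X \<phi> n \<le> B)) \<and>
         (\<not> perfect_group H \<longrightarrow>
           (\<exists>c C :: real. c > 0 \<and> C > 0 \<and>
             (\<forall>n\<ge>1. c * real n \<le> real (d_wr H X \<phi> n) \<and>
                    real (d_wr H X \<phi> n) \<le> C * real n)))"
proof -
  interpret finite_transitive_permutation_group H X \<phi> by (rule assms)
  interpret \<phi>: group_hom H "BijGroup X" \<phi> by (rule group_hom)
  let ?P = "\<phi> ` carrier H"
  interpret transitive_permutations X ?P
    by (rule transitive_permutations.intro)
       (use finite_points nonempty_points \<phi>.img_is_subgroup unique_orbit in auto)
  \<comment> \<open>As \<open>\<phi>\<close> is injective on the carrier, equality of the derived
    subgroup with the whole group can be tested on images.\<close>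
  have perfect: "perfect_group H \<longleftrightarrow> derived (BijGroup X) ?P = ?P"
    using \<phi>.derived_img[of "carrier H"] \<phi>.G.derived_in_carrier[of "carrier H"]
      inj_on_image_eq_iff[OF faithful] \<phi>.G.is_group
    by (auto simp: perfect_group_def)
  have d: "d_wr H X \<phi> n = min_generators (B n\<lparr>carrier := W n\<rparr>)" for n
    by (simp add: d_wr_def wreath_power_group_def)
  have "\<exists>B. \<forall>n\<ge>1. d_wr H X \<phi> n \<le> B" if "perfect_group H"
    using min_generators_W_perfect that unfolding perfect d by blast
  moreover have "\<exists>c C :: real. c > 0 \<and> C > 0 \<and> (\<forall>n\<ge>1. c * real n \<le> real (d_wr H X \<phi> n) \<and>
      real (d_wr H X \<phi> n) \<le> C * real n)" if "\<not> perfect_group H"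
  \<comment> \<open>The constant c = 1 comes from the abelianization; C counts the identity of
    \<open>?P\<close> as well, which keeps it positive in any case.\<close>
  proof (rule exI[of _ 1], rule exI[of _ "real (card ?P)"], intro conjI allI impI)
    show "real (card ?P) > 0" using finite_P P_one card_gt_0_iff by (metis empty_iff of_nat_0_less_iff)
    fix n :: nat
    show "1 * real n \<le> real (d_wr H X \<phi> n)"
      using le_min_generators_W_not_perfect[of n] that unfolding perfect d by simp
    have "d_wr H X \<phi> n \<le> n * card ?P"
      unfolding d using min_generators_W_linear[of n] card_Diff1_le[of ?P]
      by (meson le_trans mult_le_mono2)
    then show "real (d_wr H X \<phi> n) \<le> real (card ?P) * real n"
      by (metis mult.commute of_nat_le_iff of_nat_mult)
  qed simp
  ultimately show ?thesis by blast
qed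

end
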